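(* Let $A$ be a finite simplicial complex. Then the category $\mathcal{S}(A)$ of selections on $A$ is a projective Fra\"iss\'e category.
   Context: A simplicial complex is a family of finite non-empty sets closed under non-empty subsets; $\mathrm{dom}(C)=\bigcup C$; for $f\colon\mathrm{dom}(C)\to\mathrm{dom}(D)$, $f_*(\sigma)=\{f(v):v\in\sigma\}$, and $f$ is simplicial if $f_*(\sigma)\in D$ for all $\sigma\in C$. The barycentric subdivision $\beta C$ has vertex set $C$ and faces the non-empty chains under inclusion of faces of $C$; $\beta^0C=C$, $\beta^{k+1}C=\beta(\beta^kC)$. For simplicial $f\colon C\to D$, $\beta f\colon\beta C\to\beta D$ is $\sigma\mapsto f_*(\sigma)$. An elementary selection is a map $s\colon\beta C\to C$ with $s(\sigma)\in\sigma$ for every $\sigma\in C$ (it is a simplicial surjection). $\mathcal{S}(A)$ is the smallest family of simplicial maps that contains all elementary selections $\beta^{k+1}A\to\beta^kA$ ($k\ge0$) and the identity $1_A$, and is closed under composition and under $f\mapsto\beta f$; it is a category with objects $\beta^kA$, $k\ge0$. A category $\mathcal E$ is essentially countable if its objects are countably many up to isomorphism and there are countably many morphisms between any two objects. A projective Fra\"iss\'e category is an essentially countable category with (joint projection) for any objects $o_1,o_2$ there are morphisms $e_1,e_2$ with $\mathrm{codom}(e_i)=o_i$ and $\mathrm{dom}(e_1)=\mathrm{dom}(e_2)$, and (projective amalgamation) for any morphisms $e_1,e_2$ with the same codomain there are morphisms $e_1',e_2'$ with $e_1\circ e_1'=e_2\circ e_2'$. *)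

theory Defs
  imports Main "HOL-Library.FSet" "HOL-Library.FuncSet" "HOL-Library.Countable_Set"
begin

record ('o, 'm) cat =
  Ob :: "'o set"
  Mor :: "'m set"
  Dom :: "'m \<Rightarrow> 'o"
  Cod :: "'m \<Rightarrow> 'o"
  Id :: "'o \<Rightarrow> 'm"
  Comp :: "'m \<Rightarrow> 'm \<Rightarrow> 'm"  (infixl "\<cdot>\<index>" 70)

locale category =
  fixes \<E> :: "('o, 'm) cat" (structure)
  assumes Dom_in: "f \<in> Mor \<E> \<Longrightarrow> Dom \<E> f \<in> Ob \<E>"
    and Cod_in: "f \<in> Mor \<E> \<Longrightarrow> Cod \<E> f \<in> Ob \<E>"
    and Id_in: "x \<in> Ob \<E> \<Longrightarrow> Id \<E> x \<in> Mor \<E>"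
    and Dom_Id: "x \<in> Ob \<E> \<Longrightarrow> Dom \<E> (Id \<E> x) = x"
    and Cod_Id: "x \<in> Ob \<E> \<Longrightarrow> Cod \<E> (Id \<E> x) = x"
    and Comp_in: "\<lbrakk>f \<in> Mor \<E>; g \<in> Mor \<E>; Dom \<E> g = Cod \<E> f\<rbrakk> \<Longrightarrow> g \<cdot> f \<in> Mor \<E>"
    and Dom_Comp: "\<lbrakk>f \<in> Mor \<E>; g \<in> Mor \<E>; Dom \<E> g = Cod \<E> f\<rbrakk> \<Longrightarrow> Dom \<E> (g \<cdot> f) = Dom \<E> f"
    and Cod_Comp: "\<lbrakk>f \<in> Mor \<E>; g \<in> Mor \<E>; Dom \<E> g = Cod \<E> f\<rbrakk> \<Longrightarrow> Cod \<E> (g \<cdot> f) = Cod \<E> g"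
    and Comp_Id: "f \<in> Mor \<E> \<Longrightarrow> f \<cdot> Id \<E> (Dom \<E> f) = f"
    and Id_Comp: "f \<in> Mor \<E> \<Longrightarrow> Id \<E> (Cod \<E> f) \<cdot> f = f"
    and Comp_assoc: "\<lbrakk>f \<in> Mor \<E>; g \<in> Mor \<E>; h \<in> Mor \<E>; Dom \<E> g = Cod \<E> f; Dom \<E> h = Cod \<E> g\<rbrakk>
      \<Longrightarrow> h \<cdot> (g \<cdot> f) = (h \<cdot> g) \<cdot> f"

definition Hom :: "('o, 'm) cat \<Rightarrow> 'o \<Rightarrow> 'o \<Rightarrow> 'm set" where
  "Hom \<E> x y = {f \<in> Mor \<E>. Dom \<E> f = x \<and> Cod \<E> f = y}"

definition isomorphic :: "('o, 'm) cat \<Rightarrow> 'o \<Rightarrow> 'o \<Rightarrow> bool" where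
  "isomorphic \<E> x y \<longleftrightarrow>
     (\<exists>f \<in> Hom \<E> x y. \<exists>g \<in> Hom \<E> y x. Comp \<E> g f = Id \<E> x \<and> Comp \<E> f g = Id \<E> y)"

locale essentially_countable_category = category +
  assumes countable_Ob_up_to_iso:
      "\<exists>R \<subseteq> Ob \<E>. countable R \<and> (\<forall>x \<in> Ob \<E>. \<exists>r \<in> R. isomorphic \<E> x r)"
    and countable_Hom: "\<lbrakk>x \<in> Ob \<E>; y \<in> Ob \<E>\<rbrakk> \<Longrightarrow> countable (Hom \<E> x y)"

locale projective_fraisse_category = essentially_countable_category +
  assumes joint_projection:
      "\<lbrakk>o1 \<in> Ob \<E>; o2 \<in> Ob \<E>\<rbrakk> \<Longrightarrow>
        \<exists>e1 \<in> Mor \<E>. \<exists>e2 \<in> Mor \<E>. Cod \<E> e1 = o1 \<and> Cod \<E> e2 = o2 \<and> Dom \<E> e1 = Dom \<E> e2"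
    and projective_amalgamation:
      "\<lbrakk>e1 \<in> Mor \<E>; e2 \<in> Mor \<E>; Cod \<E> e1 = Cod \<E> e2\<rbrakk> \<Longrightarrow>
        \<exists>e1' \<in> Mor \<E>. \<exists>e2' \<in> Mor \<E>.
          Cod \<E> e1' = Dom \<E> e1 \<and> Cod \<E> e2' = Dom \<E> e2 \<and> Dom \<E> e1' = Dom \<E> e2' \<and>
          e1 \<cdot> e1' = e2 \<cdot> e2'"

definition simplicial_complex :: "'v fset set \<Rightarrow> bool" where
  "simplicial_complex C \<longleftrightarrow>
     {||} \<notin> C \<and> (\<forall>\<sigma> \<in> C. \<forall>\<tau>. \<tau> \<noteq> {||} \<and> \<tau> |\<subseteq>| \<sigma> \<longrightarrow> \<tau> \<in> C)"

definition vertices :: "'v fset set \<Rightarrow> 'v set" where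
  "vertices C = (\<Union>\<sigma> \<in> C. fset \<sigma>)"

text \<open>A map is a function that is \<open>undefined\<close> off the vertices of its source, so that
  equality of functions is equality of maps.\<close>

definition simplicial :: "'v fset set \<Rightarrow> 'w fset set \<Rightarrow> ('v \<Rightarrow> 'w) \<Rightarrow> bool" where
  "simplicial C D f \<longleftrightarrow> f \<in> vertices C \<rightarrow>\<^sub>E vertices D \<and> (\<forall>\<sigma> \<in> C. f |`| \<sigma> \<in> D)"

text \<open>The vertices of a subdivision are the faces of the complex subdivided, so iterating
  subdivision needs a type of vertices that contains its own finite subsets: the hereditarily
  finite sets over atoms from \<open>'a\<close>. A complex over an arbitrary type \<open>'a\<close> enters through
  the constructor \<open>Atom\<close>; see \<open>simplicial_complex_Atom\<close>.\<close>

datatype 'a vert = Atom 'a | Face (face: "'a vert fset")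

definition subdiv :: "'a vert fset set \<Rightarrow> 'a vert fset set" where
  "subdiv C = {Face |`| c | c. c \<noteq> {||} \<and> fset c \<subseteq> C \<and>
      (\<forall>\<sigma> \<in> fset c. \<forall>\<tau> \<in> fset c. \<sigma> |\<subseteq>| \<tau> \<or> \<tau> |\<subseteq>| \<sigma>)}"

definition subdiv_map :: "'a vert fset set \<Rightarrow> ('a vert \<Rightarrow> 'a vert) \<Rightarrow> 'a vert \<Rightarrow> 'a vert" where
  "subdiv_map C f = (\<lambda>v \<in> vertices (subdiv C). Face (f |`| face v))"

definition elementary_selection :: "'a vert fset set \<Rightarrow> ('a vert \<Rightarrow> 'a vert) \<Rightarrow> bool" where
  "elementary_selection C s \<longleftrightarrow>
     s \<in> vertices (subdiv C) \<rightarrow>\<^sub>E vertices C \<and> (\<forall>\<sigma> \<in> C. s (Face \<sigma>) \<in> fset \<sigma>)"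

datatype 'v smap = SMap (source: "'v fset set") (fn: "'v \<Rightarrow> 'v") (target: "'v fset set")

definition smap_id :: "'v fset set \<Rightarrow> 'v smap" where
  "smap_id C = SMap C (\<lambda>v \<in> vertices C. v) C"

definition smap_comp :: "'v smap \<Rightarrow> 'v smap \<Rightarrow> 'v smap" where
  "smap_comp g f = SMap (source f) (compose (vertices (source f)) (fn g) (fn f)) (target g)"

definition smap_subdiv :: "'a vert smap \<Rightarrow> 'a vert smap" where
  "smap_subdiv f = SMap (subdiv (source f)) (subdiv_map (source f) (fn f)) (subdiv (target f))"

inductive_set selections :: "'a vert fset set \<Rightarrow> 'a vert smap set"
  for A :: "'a vert fset set"
where
  elementary: "elementary_selection ((subdiv ^^ k) A) s \<Longrightarrow>
    SMap ((subdiv ^^ Suc k) A) s ((subdiv ^^ k) A) \<in> selections A"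
| identity: "smap_id A \<in> selections A"
| composition: "\<lbrakk>f \<in> selections A; g \<in> selections A; source g = target f\<rbrakk> \<Longrightarrow>
    smap_comp g f \<in> selections A"
| subdivision: "f \<in> selections A \<Longrightarrow> smap_subdiv f \<in> selections A"

definition selection_category :: "'a vert fset set \<Rightarrow> ('a vert fset set, 'a vert smap) cat" where
  "selection_category A =
     \<lparr>Ob = range (\<lambda>k. (subdiv ^^ k) A), Mor = selections A, Dom = source, Cod = target,
      Id = smap_id, Comp = smap_comp\<rparr>"

lemma simplicial_complex_Atom:
  fixes C :: "'a fset set"
  assumes "simplicial_complex C"
  shows "simplicial_complex ((\<lambda>\<sigma>. Atom |`| \<sigma>) ` C)"
  unfolding simplicial_complex_def
proof (intro conjI ballI allI impI)
  show "{||} \<notin> (\<lambda>\<sigma>. Atom |`| \<sigma>) ` C"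
    using assms by (auto simp: simplicial_complex_def)
next
  fix \<rho> \<tau> :: "'a vert fset"
  assume "\<rho> \<in> (\<lambda>\<sigma>. Atom |`| \<sigma>) ` C" and \<tau>: "\<tau> \<noteq> {||} \<and> \<tau> |\<subseteq>| \<rho>"
  then obtain \<sigma> where \<sigma>: "\<sigma> \<in> C" "\<rho> = Atom |`| \<sigma>" by blast
  with \<tau> obtain \<tau>' where "\<tau>' |\<subseteq>| \<sigma>" "\<tau> = Atom |`| \<tau>'"
    using subset_fimage_iff by metis
  with \<sigma> \<tau> assms show "\<tau> \<in> (\<lambda>\<sigma>. Atom |`| \<sigma>) ` C"
    by (auto simp: simplicial_complex_def)
qed

lemma vertices_subdiv: "vertices (subdiv C) = Face ` C"
proof
  show "vertices (subdiv C) \<subseteq> Face ` C"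
    by (auto simp: vertices_def subdiv_def)
  show "Face ` C \<subseteq> vertices (subdiv C)"
  proof
    fix v assume "v \<in> Face ` C"
    then obtain \<sigma> where "\<sigma> \<in> C" "v = Face \<sigma>" by blast
    moreover from this have "Face |`| {|\<sigma>|} \<in> subdiv C"
      unfolding subdiv_def by (intro CollectI exI[of _ "{|\<sigma>|}"]) auto
    ultimately show "v \<in> vertices (subdiv C)"
      by (auto simp: vertices_def)
  qed
qed

lemma simplicial_complex_subdiv: "simplicial_complex (subdiv C)"
  unfolding simplicial_complex_def
proof (intro conjI ballI allI impI)
  show "{||} \<notin> subdiv C" by (auto simp: subdiv_def)
next
  fix \<rho> \<tau> assume "\<rho> \<in> subdiv C" and \<tau>: "\<tau> \<noteq> {||} \<and> \<tau> |\<subseteq>| \<rho>"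
  then obtain c where c: "\<rho> = Face |`| c" "fset c \<subseteq> C"
    "\<forall>\<sigma> \<in> fset c. \<forall>\<tau> \<in> fset c. \<sigma> |\<subseteq>| \<tau> \<or> \<tau> |\<subseteq>| \<sigma>"
    by (auto simp: subdiv_def)
  with \<tau> obtain d where d: "d |\<subseteq>| c" "\<tau> = Face |`| d"
    using subset_fimage_iff by metis
  have "d \<noteq> {||} \<and> fset d \<subseteq> C \<and> (\<forall>\<sigma> \<in> fset d. \<forall>\<tau> \<in> fset d. \<sigma> |\<subseteq>| \<tau> \<or> \<tau> |\<subseteq>| \<sigma>)"
    using \<tau> c d by (auto simp: less_eq_fset.rep_eq)
  with d show "\<tau> \<in> subdiv C" unfolding subdiv_def by blast
qed

lemma simplicial_complex_subdiv_iterate: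
  "simplicial_complex A \<Longrightarrow> simplicial_complex ((subdiv ^^ k) A)"
  by (cases k) (auto simp: simplicial_complex_subdiv)

lemma fchain_has_top:
  assumes "c \<noteq> {||}" "\<forall>\<sigma> \<in> fset c. \<forall>\<tau> \<in> fset c. \<sigma> |\<subseteq>| \<tau> \<or> \<tau> |\<subseteq>| \<sigma>"
  shows "\<exists>\<rho> \<in> fset c. \<forall>\<sigma> \<in> fset c. \<sigma> |\<subseteq>| \<rho>"
proof -
  have "fset c \<noteq> {}" using assms(1) by auto
  then obtain \<rho> where "\<rho> \<in> fset c" "\<forall>\<sigma> \<in> fset c. \<rho> |\<subseteq>| \<sigma> \<longrightarrow> \<rho> = \<sigma>"
    using finite_has_maximal[of "fset c"] by auto
  with assms(2) show ?thesis by blast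
qed

lemma elementary_selection_simplicial:
  assumes C: "simplicial_complex C" and s: "elementary_selection C s"
  shows "simplicial (subdiv C) C s"
  unfolding simplicial_def
proof (intro conjI ballI)
  show "s \<in> vertices (subdiv C) \<rightarrow>\<^sub>E vertices C"
    using s by (simp add: elementary_selection_def)
next
  fix \<sigma> assume "\<sigma> \<in> subdiv C"
  then obtain c where c: "\<sigma> = Face |`| c" "c \<noteq> {||}" "fset c \<subseteq> C"
    "\<forall>\<sigma> \<in> fset c. \<forall>\<tau> \<in> fset c. \<sigma> |\<subseteq>| \<tau> \<or> \<tau> |\<subseteq>| \<sigma>"
    by (auto simp: subdiv_def)
  then obtain \<rho> where \<rho>: "\<rho> \<in> fset c" "\<forall>\<sigma> \<in> fset c. \<sigma> |\<subseteq>| \<rho>"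
    using fchain_has_top by blast
  have sel: "s (Face \<tau>) \<in> fset \<tau>" if "\<tau> \<in> fset c" for \<tau>
    using s c(3) that by (auto simp: elementary_selection_def)
  have "s |`| \<sigma> |\<subseteq>| \<rho>"
    using \<rho> sel c(1) by (auto simp: less_eq_fset.rep_eq)
  moreover have "s |`| \<sigma> \<noteq> {||}" using c by auto
  ultimately show "s |`| \<sigma> \<in> C"
    using C \<rho>(1) c(3) unfolding simplicial_complex_def by blast
qed

lemma elementary_selection_surj:
  assumes C: "simplicial_complex C" and s: "elementary_selection C s"
  shows "s ` vertices (subdiv C) = vertices C"
proof
  show "s ` vertices (subdiv C) \<subseteq> vertices C"
    using s by (auto simp: elementary_selection_def)
  show "vertices C \<subseteq> s ` vertices (subdiv C)"
  proof
    fix v assume "v \<in> vertices C"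
    then obtain \<sigma> where \<sigma>: "\<sigma> \<in> C" "v \<in> fset \<sigma>" by (auto simp: vertices_def)
    then have v: "{|v|} \<in> C" using C by (auto simp: simplicial_complex_def)
    then have "s (Face {|v|}) \<in> fset {|v|}" using s unfolding elementary_selection_def by blast
    then have "s (Face {|v|}) = v" by simp
    with v show "v \<in> s ` vertices (subdiv C)" unfolding vertices_subdiv by force
  qed
qed

lemma simplicial_subdiv_map:
  assumes f: "simplicial C D f"
  shows "simplicial (subdiv C) (subdiv D) (subdiv_map C f)"
  unfolding simplicial_def
proof (intro conjI ballI)
  show "subdiv_map C f \<in> vertices (subdiv C) \<rightarrow>\<^sub>E vertices (subdiv D)"
    using f by (auto simp: subdiv_map_def vertices_subdiv simplicial_def)
next
  fix \<sigma> assume "\<sigma> \<in> subdiv C"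
  then obtain c where c: "\<sigma> = Face |`| c" "c \<noteq> {||}" "fset c \<subseteq> C"
    "\<forall>\<sigma> \<in> fset c. \<forall>\<tau> \<in> fset c. \<sigma> |\<subseteq>| \<tau> \<or> \<tau> |\<subseteq>| \<sigma>"
    by (auto simp: subdiv_def)
  let ?d = "(\<lambda>\<tau>. f |`| \<tau>) |`| c"
  have eq: "subdiv_map C f |`| \<sigma> = Face |`| ?d"
    unfolding c(1) fset.map_comp using c(3)
    by (intro fset.map_cong0) (auto simp: subdiv_map_def vertices_subdiv)
  have "fset ?d \<subseteq> D" using f c(3) by (auto simp: simplicial_def)
  moreover have "\<forall>\<sigma> \<in> fset ?d. \<forall>\<tau> \<in> fset ?d. \<sigma> |\<subseteq>| \<tau> \<or> \<tau> |\<subseteq>| \<sigma>"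
    using c(4) by simp (meson fimage_mono)
  moreover have "?d \<noteq> {||}" using c(2) by simp
  ultimately show "subdiv_map C f |`| \<sigma> \<in> subdiv D"
    unfolding eq subdiv_def by blast
qed

lemma simplicial_compose:
  assumes f: "simplicial C D f" and g: "simplicial D E g"
  shows "simplicial C E (compose (vertices C) g f)"
  unfolding simplicial_def
proof (intro conjI ballI)
  show "compose (vertices C) g f \<in> vertices C \<rightarrow>\<^sub>E vertices E"
    using f g by (auto simp: simplicial_def compose_def)
next
  fix \<sigma> assume \<sigma>: "\<sigma> \<in> C"
  have "compose (vertices C) g f |`| \<sigma> = g |`| (f |`| \<sigma>)"
    unfolding fset.map_comp using \<sigma>
    by (intro fset.map_cong0) (auto simp: compose_def vertices_def)
  also have "\<dots> \<in> E" using f g \<sigma> unfolding simplicial_def by blast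
  finally show "compose (vertices C) g f |`| \<sigma> \<in> E" .
qed

lemma simplicial_identity: "simplicial C C (\<lambda>v \<in> vertices C. v)"
proof -
  have "(\<lambda>v \<in> vertices C. v) |`| \<sigma> = \<sigma>" if "\<sigma> \<in> C" for \<sigma>
  proof -
    have "(\<lambda>v \<in> vertices C. v) |`| \<sigma> = id |`| \<sigma>"
      using that by (intro fset.map_cong0) (auto simp: vertices_def)
    then show ?thesis by (simp add: fset.map_id)
  qed
  then show ?thesis by (auto simp: simplicial_def)
qed

lemma selections_simplicial:
  assumes A: "simplicial_complex A" and "f \<in> selections A"
  shows "simplicial (source f) (target f) (fn f)"
  using assms(2)
proof induction
  case (elementary k s)
  then show ?case
    using elementary_selection_simplicial[OF simplicial_complex_subdiv_iterate[OF A]] by simp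
next
  case identity
  show ?case using simplicial_identity[of A] by (simp only: smap_id_def smap.sel)
next
  case (composition f g)
  then show ?case by (auto simp: smap_comp_def intro: simplicial_compose)
next
  case (subdivision f)
  then show ?case by (simp add: smap_subdiv_def simplicial_subdiv_map)
qed

end

theory Submission
  imports Defs
begin

text \<open>If \<open>s\<close> is an elementary selection on \<open>D\<close> and \<open>f : C \<rightarrow> D\<close> is simplicial, then
  \<open>s (f\<^sub>* \<sigma>) \<in> f\<^sub>* \<sigma>\<close>, so one can choose \<open>s' \<sigma> \<in> \<sigma>\<close> with \<open>f (s' \<sigma>) = s (f\<^sub>* \<sigma>)\<close>; that is,
  \<open>f \<circ> s' = s \<circ> \<beta>f\<close>. Applying \<open>\<beta>\<close> to such squares, every iterated subdivision \<open>\<beta>\<^sup>n s\<close> of an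
  elementary selection amalgamates with every selection, the map opposite to \<open>\<beta>\<^sup>n s\<close> in the
  square being again of this form. Since \<open>\<beta>\<close> is a functor, every selection is a composition of
  such maps, and amalgamation follows by pasting squares.\<close>

section \<open>Composition, identities and the subdivision functor\<close>

lemma smap_comp_sel [simp]:
  "source (smap_comp g f) = source f" "target (smap_comp g f) = target g"
  by (simp_all add: smap_comp_def)

lemma smap_id_sel [simp]: "source (smap_id C) = C" "target (smap_id C) = C"
  by (simp_all add: smap_id_def)

lemma smap_subdiv_sel [simp]:
  "source (smap_subdiv f) = subdiv (source f)" "target (smap_subdiv f) = subdiv (target f)"
  by (simp_all add: smap_subdiv_def)

text \<open>\<open>compose\<close> yields \<open>undefined\<close> off its domain, so the composite
  of \<open>h\<close> and \<open>g\<close> has the right value only on vertices of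
  \<open>source g\<close>; \<open>f\<close> being simplicial puts its values there.\<close>

lemma smap_comp_assoc:
  assumes "simplicial (source f) (target f) (fn f)" "source g = target f"
  shows "smap_comp h (smap_comp g f) = smap_comp (smap_comp h g) f"
  using assms by (auto simp: smap_comp_def simplicial_def compose_def fun_eq_iff)

text \<open>Composing with an identity restricts \<open>f\<close> to the vertices of its source;
  extensionality, contained in \<open>simplicial\<close>, makes this restriction equal to
  \<open>f\<close>.\<close>

lemma smap_comp_id:
  assumes "simplicial (source f) (target f) (fn f)"
  shows "smap_comp f (smap_id (source f)) = f"
  using assms
  by (cases f) (auto simp: smap_comp_def smap_id_def simplicial_def compose_def fun_eq_iff
      PiE_def extensional_def)

lemma smap_id_comp:
  assumes "simplicial (source f) (target f) (fn f)"
  shows "smap_comp (smap_id (target f)) f = f"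
  using assms
  by (cases f) (auto simp: smap_comp_def smap_id_def simplicial_def compose_def fun_eq_iff
      PiE_def extensional_def)

lemma smap_subdiv_id: "smap_subdiv (smap_id C) = smap_id (subdiv C)"
proof -
  have "(\<lambda>v\<in>vertices C. v) |`| \<sigma> = \<sigma>" if "\<sigma> \<in> C" for \<sigma>
  proof -
    have "(\<lambda>v\<in>vertices C. v) |`| \<sigma> = id |`| \<sigma>"
      using that by (intro fset.map_cong0) (auto simp: vertices_def)
    then show ?thesis by (simp add: fset.map_id)
  qed
  then show ?thesis
    unfolding smap_subdiv_def smap_id_def subdiv_map_def vertices_subdiv smap.sel
    by (intro arg_cong[where f = "\<lambda>h. SMap _ h _"] restrict_ext)
      (elim imageE, simp only: vert.sel)
qed

text \<open>With \<open>smap_subdiv_id\<close> this makes \<beta> a functor. Both sides send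
  \<open>Face \<sigma>\<close> to the image of \<sigma> under \<open>f\<close> and then
  \<open>g\<close>; \<open>f\<close> being simplicial makes the intermediate image a face of
  \<open>target f\<close>, where the subdivision of \<open>g\<close> is defined.\<close>

lemma smap_subdiv_comp:
  assumes "simplicial (source f) (target f) (fn f)" "source g = target f"
  shows "smap_subdiv (smap_comp g f) = smap_comp (smap_subdiv g) (smap_subdiv f)"
proof -
  let ?C = "source f"
  have "compose (vertices ?C) (fn g) (fn f) |`| \<sigma> = fn g |`| (fn f |`| \<sigma>)" if "\<sigma> \<in> ?C" for \<sigma>
    unfolding fset.map_comp using that
    by (intro fset.map_cong0) (auto simp: compose_def vertices_def)
  moreover have "fn f |`| \<sigma> \<in> target f" if "\<sigma> \<in> ?C" for \<sigma>
    using that assms(1) by (auto simp: simplicial_def)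
  ultimately have "subdiv_map ?C (compose (vertices ?C) (fn g) (fn f)) =
      compose (vertices (subdiv ?C)) (subdiv_map (target f) (fn g)) (subdiv_map ?C (fn f))"
    unfolding subdiv_map_def vertices_subdiv compose_def[of "Face ` _"]
    by (intro restrict_ext) (elim imageE, simp del: fset.map_comp)
  then show ?thesis
    using assms(2) by (simp add: smap_subdiv_def smap_comp_def)
qed

section \<open>Injectivity and finiteness of subdivision\<close>

lemma inj_subdiv: "inj subdiv"
proof (rule injI)
  fix C D :: "'a vert fset set"
  assume "subdiv C = subdiv D"
  then have "Face ` C = Face ` D" by (metis vertices_subdiv)
  then show "C = D" by (simp add: inj_image_eq_iff inj_def)
qed

lemma finite_vertices: "finite C \<Longrightarrow> finite (vertices C)"
  by (simp add: vertices_def)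

lemma finite_subdiv:
  assumes "finite C"
  shows "finite (subdiv C)"
proof -
  \<comment> \<open>A face of the subdivision is a set of vertices \<open>Face \<sigma>\<close> with
    \<sigma> in \<open>C\<close>, so finitely many underlying sets occur; injectivity of
    \<open>fset\<close> carries this back to \<open>subdiv C\<close>.\<close>
  have "fset ` subdiv C \<subseteq> Pow (Face ` C)"
    unfolding subdiv_def by auto
  then have "finite (fset ` subdiv C)"
    using assms finite_subset by blast
  then show ?thesis
    by (rule finite_imageD) (simp add: inj_on_def fset_inject)
qed

lemma finite_subdiv_iterate: "finite A \<Longrightarrow> finite ((subdiv ^^ k) A)"
  by (induction k) (simp_all add: finite_subdiv)

section \<open>Construction and lifting of elementary selections\<close>

lemma elementary_selection_choice:
  assumes "\<And>\<sigma>. \<sigma> \<in> C \<Longrightarrow> p \<sigma> \<in> fset \<sigma>"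
  shows "elementary_selection C (\<lambda>v\<in>vertices (subdiv C). p (face v))"
proof -
  have "p \<sigma> \<in> vertices C" if "\<sigma> \<in> C" for \<sigma>
    using assms that by (auto simp: vertices_def)
  then show ?thesis
    using assms by (auto simp: elementary_selection_def vertices_subdiv)
qed

lemma elementary_selection_exists:
  assumes "simplicial_complex C"
  shows "\<exists>s. elementary_selection C s"
proof -
  have "\<exists>v. v \<in> fset \<sigma>" if "\<sigma> \<in> C" for \<sigma>
    using that assms by (metis all_not_fin_conv simplicial_complex_def)
  then obtain p where p: "\<And>\<sigma>. \<sigma> \<in> C \<Longrightarrow> p \<sigma> \<in> fset \<sigma>" by metis
  then show ?thesis using elementary_selection_choice by blast
qed

lemma elementary_selection_lift:
  assumes f: "simplicial (source f) (target f) (fn f)" and s: "elementary_selection (target f) s"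
  shows "\<exists>s'. elementary_selection (source f) s' \<and>
    smap_comp f (SMap (subdiv (source f)) s' (source f)) =
    smap_comp (SMap (subdiv (target f)) s (target f)) (smap_subdiv f)"
proof -
  let ?C = "source f"
  have "\<exists>v. v \<in> fset \<sigma> \<and> fn f v = s (Face (fn f |`| \<sigma>))" if "\<sigma> \<in> ?C" for \<sigma>
  proof -
    have "fn f |`| \<sigma> \<in> target f" using f that by (simp add: simplicial_def)
    then have "s (Face (fn f |`| \<sigma>)) \<in> fset (fn f |`| \<sigma>)"
      using s unfolding elementary_selection_def by blast
    then show ?thesis by auto
  qed
  then obtain p where
    p: "\<And>\<sigma>. \<sigma> \<in> ?C \<Longrightarrow> p \<sigma> \<in> fset \<sigma> \<and> fn f (p \<sigma>) = s (Face (fn f |`| \<sigma>))"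
    by metis
  define s' where "s' = (\<lambda>v\<in>vertices (subdiv ?C). p (face v))"
  have "elementary_selection ?C s'"
    unfolding s'_def using p by (intro elementary_selection_choice) blast
  \<comment> \<open>At \<open>Face \<sigma>\<close> both composites take the value that
    \<open>p\<close> was chosen to realise; off the vertices both are
    \<open>undefined\<close>.\<close>
  moreover have "smap_comp f (SMap (subdiv ?C) s' ?C) =
      smap_comp (SMap (subdiv (target f)) s (target f)) (smap_subdiv f)"
    using p by (auto simp: s'_def smap_comp_def smap_subdiv_def subdiv_map_def compose_def
        vertices_subdiv fun_eq_iff)
  ultimately show ?thesis by blast
qed

section \<open>Objects, hom-sets and projections to lower subdivisions\<close>

lemma smap_id_in_selections: "smap_id ((subdiv ^^ k) A) \<in> selections A"
proof (induction k)
  case 0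
  show ?case by (simp add: selections.identity)
next
  case (Suc k)
  from selections.subdivision[OF this] show ?case by (simp add: smap_subdiv_id)
qed

lemma selections_source_target:
  assumes "f \<in> selections A"
  shows "source f \<in> range (\<lambda>k. (subdiv ^^ k) A)" and "target f \<in> range (\<lambda>k. (subdiv ^^ k) A)"
proof -
  have "(\<exists>k. source f = (subdiv ^^ k) A) \<and> (\<exists>k. target f = (subdiv ^^ k) A)"
    using assms
  proof induction
    case (elementary k s)
    show ?case by (auto intro: exI[of _ "Suc k"])
  next
    case identity
    show ?case by (auto intro: exI[of _ 0])
  next
    case (composition f g)
    then show ?case by simp
  next
    case (subdivision f)
    then show ?case by (metis smap_subdiv_sel funpow.simps(2) comp_apply)
  qed
  then show "source f \<in> range (\<lambda>k. (subdiv ^^ k) A)" "target f \<in> range (\<lambda>k. (subdiv ^^ k) A)"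
    by blast+
qed

text \<open>Since a selection is simplicial, it is determined by an extensional function between two
  finite vertex sets.\<close>

lemma finite_selections_between:
  assumes "simplicial_complex A" "finite C" "finite D"
  shows "finite {f \<in> selections A. source f = C \<and> target f = D}"
proof (rule finite_subset)
  show "{f \<in> selections A. source f = C \<and> target f = D} \<subseteq>
      (\<lambda>h. SMap C h D) ` (vertices C \<rightarrow>\<^sub>E vertices D)"
  proof
    fix f assume "f \<in> {f \<in> selections A. source f = C \<and> target f = D}"
    then have "f = SMap C (fn f) D" "fn f \<in> vertices C \<rightarrow>\<^sub>E vertices D"
      using selections_simplicial[OF assms(1), of f] by (auto simp: simplicial_def)
    then show "f \<in> (\<lambda>h. SMap C h D) ` (vertices C \<rightarrow>\<^sub>E vertices D)" by blast
  qed
  show "finite ((\<lambda>h. SMap C h D) ` (vertices C \<rightarrow>\<^sub>E vertices D))"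
    using assms by (intro finite_imageI finite_PiE) (simp_all add: finite_vertices)
qed

text \<open>For joint projection: the (m+n)-th subdivision maps to both the m-th and the n-th. Each
  elementary selection undoes one subdivision.\<close>

lemma selection_down:
  assumes A: "simplicial_complex A"
  shows "\<exists>f \<in> selections A. source f = (subdiv ^^ (m + k)) A \<and> target f = (subdiv ^^ k) A"
proof (induction m)
  case 0
  show ?case by (rule bexI[OF _ smap_id_in_selections[of k]]) simp
next
  case (Suc m)
  then obtain f where f: "f \<in> selections A" "source f = (subdiv ^^ (m + k)) A"
    "target f = (subdiv ^^ k) A" by blast
  obtain s where s: "elementary_selection ((subdiv ^^ (m + k)) A) s"
    using elementary_selection_exists simplicial_complex_subdiv_iterate[OF A] by blast
  show ?case
    by (rule bexI[OF _ selections.composition[OF selections.elementary[OF s] f(1)]])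
      (simp_all add: f)
qed

section \<open>Steps, meaning iterated subdivisions of elementary selections, and amalgamation
  squares\<close>

inductive_set selection_steps :: "'a vert fset set \<Rightarrow> 'a vert smap set"
  for A :: "'a vert fset set"
where
  elementary: "elementary_selection ((subdiv ^^ k) A) s \<Longrightarrow>
    SMap ((subdiv ^^ Suc k) A) s ((subdiv ^^ k) A) \<in> selection_steps A"
| subdivision: "t \<in> selection_steps A \<Longrightarrow> smap_subdiv t \<in> selection_steps A"

lemma selection_steps_selections: "t \<in> selection_steps A \<Longrightarrow> t \<in> selections A"
  by (induction rule: selection_steps.induct)
    (auto simp del: funpow.simps intro: selections.intros)

text \<open>A primed map is the side opposite to its unprimed namesake, so \<open>f\<close> is
  followed after \<open>g'\<close>, and \<open>g\<close> after \<open>f'\<close>.\<close>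

definition amalgam_square :: "'v smap \<Rightarrow> 'v smap \<Rightarrow> 'v smap \<Rightarrow> 'v smap \<Rightarrow> bool" where
  "amalgam_square f g f' g' \<longleftrightarrow> target f' = source g \<and> target g' = source f \<and>
     source f' = source g' \<and> smap_comp f g' = smap_comp g f'"

lemma amalgam_square_sym: "amalgam_square f g f' g' \<Longrightarrow> amalgam_square g f g' f'"
  by (auto simp: amalgam_square_def)

text \<open>The two squares share the side \<open>f'\<close>; gluing along it only moves brackets,
  and the simplicial hypotheses of associativity come from membership in
  \<open>selections\<close>.\<close>

lemma amalgam_square_paste:
  assumes A: "simplicial_complex A"
    and sel: "f \<in> selections A" "f' \<in> selections A" "f'' \<in> selections A" "g \<in> selections A"
      "g' \<in> selections A" "h \<in> selections A" "h' \<in> selections A"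
    and gh: "target h = source g"
    and sq: "amalgam_square f g f' g'" "amalgam_square f' h f'' h'"
  shows "amalgam_square f (smap_comp g h) f'' (smap_comp g' h')"
proof -
  note simp' = selections_simplicial[OF A]
  have "smap_comp f (smap_comp g' h') = smap_comp (smap_comp f g') h'"
    using sq by (intro smap_comp_assoc simp' sel) (auto simp: amalgam_square_def)
  also have "\<dots> = smap_comp (smap_comp g f') h'"
    using sq by (simp add: amalgam_square_def)
  also have "\<dots> = smap_comp g (smap_comp f' h')"
    using sq by (intro smap_comp_assoc[symmetric] simp' sel) (auto simp: amalgam_square_def)
  also have "\<dots> = smap_comp g (smap_comp h f'')"
    using sq by (simp add: amalgam_square_def)
  also have "\<dots> = smap_comp (smap_comp g h) f''"
    using sq gh by (intro smap_comp_assoc simp' sel) (auto simp: amalgam_square_def)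
  finally show ?thesis
    using sq by (auto simp: amalgam_square_def)
qed

lemma amalgam_square_subdiv:
  assumes A: "simplicial_complex A"
    and sel: "f' \<in> selections A" "g' \<in> selections A"
    and sq: "amalgam_square f g f' g'"
  shows "amalgam_square (smap_subdiv f) (smap_subdiv g) (smap_subdiv f') (smap_subdiv g')"
  using sq smap_subdiv_comp[OF selections_simplicial[OF A sel(1)], of g]
    smap_subdiv_comp[OF selections_simplicial[OF A sel(2)], of f]
  by (simp add: amalgam_square_def)

lemma amalgam_square_id:
  assumes "simplicial (source t) (target t) (fn t)"
  shows "amalgam_square (smap_id (target t)) t (smap_id (source t)) t"
  using assms by (simp add: amalgam_square_def smap_comp_id smap_id_comp)

section \<open>Projective amalgamation, first against a single step\<close>

lemma selection_amalgam_elementary: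
  assumes A: "simplicial_complex A" and f: "f \<in> selections A"
    and s: "elementary_selection ((subdiv ^^ k) A) s" and k: "target f = (subdiv ^^ k) A"
  shows "\<exists>t' \<in> selection_steps A.
    amalgam_square f (SMap ((subdiv ^^ Suc k) A) s ((subdiv ^^ k) A)) (smap_subdiv f) t'"
proof -
  obtain n where n: "source f = (subdiv ^^ n) A"
    using selections_source_target(1)[OF f] by blast
  obtain s' where s': "elementary_selection ((subdiv ^^ n) A) s'"
    and eq: "smap_comp f (SMap (subdiv (source f)) s' (source f)) =
      smap_comp (SMap (subdiv (target f)) s (target f)) (smap_subdiv f)"
    using elementary_selection_lift[OF selections_simplicial[OF A f], of s] s k n by auto
  show ?thesis
    by (rule bexI[OF _ selection_steps.elementary[OF s']])
      (use eq k n in \<open>simp add: amalgam_square_def\<close>)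
qed

text \<open>Induction on \<open>f\<close> with \<open>t\<close> arbitrary. The side opposite
  \<open>t\<close> is claimed to be a step, not merely a selection, so that in a composition the
  square on the outer map hands a step to the inner one.\<close>

lemma selection_amalgam_step:
  assumes A: "simplicial_complex A" and "f \<in> selections A"
    and "t \<in> selection_steps A" "target t = target f"
  shows "\<exists>t' \<in> selection_steps A. \<exists>f' \<in> selections A. amalgam_square f t f' t'"
  using assms(2-)
proof (induction arbitrary: t)
  case (elementary k s)
  have "t \<in> selections A" by (rule selection_steps_selections[OF elementary.prems(1)])
  \<comment> \<open>The roles are exchanged: here \<open>t\<close> is the selection along which
    \<open>s\<close> is lifted, so the side opposite \<open>t\<close> is
    \<open>smap_subdiv t\<close>, a step because \<open>t\<close> is one.\<close>
  then obtain t' where t': "t' \<in> selection_steps A"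
    "amalgam_square t (SMap ((subdiv ^^ Suc k) A) s ((subdiv ^^ k) A)) (smap_subdiv t) t'"
    using selection_amalgam_elementary[OF A _ elementary.hyps] elementary.prems(2) by auto
  show ?case
    by (rule bexI[OF _ selection_steps.subdivision[OF elementary.prems(1)]],
        rule bexI[OF _ selection_steps_selections[OF t'(1)]], rule amalgam_square_sym[OF t'(2)])
next
  case identity
  have "t \<in> selections A" by (rule selection_steps_selections[OF identity.prems(1)])
  then have "amalgam_square (smap_id A) t (smap_id (source t)) t"
    using amalgam_square_id[OF selections_simplicial[OF A]] identity.prems(2) by fastforce
  moreover have "smap_id (source t) \<in> selections A"
    using selections_source_target(1)[OF \<open>t \<in> selections A\<close>] smap_id_in_selections by auto
  ultimately show ?case using identity.prems(1) by blast
next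
  case (composition f g)
  \<comment> \<open>The composite is \<open>f\<close> followed by \<open>g\<close>, so
    \<open>t\<close> meets \<open>g\<close> first and the resulting \<open>t1\<close> meets
    \<open>f\<close>.\<close>
  obtain t1 g1 where 1: "t1 \<in> selection_steps A" "g1 \<in> selections A" "amalgam_square g t g1 t1"
    using composition.IH(2)[of t] composition.prems by auto
  then have "target t1 = target f" using composition.hyps by (simp add: amalgam_square_def)
  then obtain t2 f1 where 2: "t2 \<in> selection_steps A" "f1 \<in> selections A"
    "amalgam_square f t1 f1 t2"
    using composition.IH(1)[OF 1(1)] by blast
  have "amalgam_square t (smap_comp g f) t2 (smap_comp g1 f1)"
    using 1 2 composition.hyps composition.prems(1)
    by (intro amalgam_square_paste[OF A, where f' = t1])
      (auto intro: amalgam_square_sym selection_steps_selections)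
  moreover have "smap_comp g1 f1 \<in> selections A"
    using 1 2 by (intro selections.composition) (auto simp: amalgam_square_def)
  ultimately show ?case using 2(1) amalgam_square_sym by blast
next
  case (subdivision f)
  \<comment> \<open>An elementary \<open>t\<close> lifts directly along
    \<open>smap_subdiv f\<close>. If \<open>t\<close> is the subdivision of \<open>t0\<close>,
    injectivity of \<open>subdiv\<close> matches the targets of \<open>t0\<close> and
    \<open>f\<close>, and \<beta> is applied to their square.\<close>
  from subdivision.prems(1) show ?case
  proof cases
    case (elementary k s)
    then show ?thesis
      using selection_amalgam_elementary[OF A selections.subdivision[OF subdivision.hyps], of k s]
        subdivision.prems selections.subdivision[OF selections.subdivision[OF subdivision.hyps]]
      by auto
  next
    case (subdivision t0)
    then have "target t0 = target f"
      using subdivision.prems(2) by (simp add: inj_eq[OF inj_subdiv])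
    then obtain t1 f1 where "t1 \<in> selection_steps A" "f1 \<in> selections A"
      "amalgam_square f t0 f1 t1"
      using subdivision.IH \<open>t0 \<in> selection_steps A\<close> by blast
    then show ?thesis
      using amalgam_square_subdiv[OF A] subdivision selection_steps_selections
        selection_steps.subdivision selections.subdivision by metis
  qed
qed

text \<open>The exponent \<open>n\<close> lets the induction on \<open>g\<close> absorb \<beta>:
  \<open>n\<close> subdivisions of \<open>smap_subdiv g\<close> are \<open>n + 1\<close>
  subdivisions of \<open>g\<close>. This replaces an explicit factorisation of \<open>g\<close> into
  steps.\<close>

lemma selection_amalgam:
  assumes A: "simplicial_complex A" and "g \<in> selections A"
    and "f \<in> selections A" "target f = target ((smap_subdiv ^^ n) g)"
  shows "\<exists>f' \<in> selections A. \<exists>g' \<in> selections A.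
    amalgam_square f ((smap_subdiv ^^ n) g) f' g'"
  using assms(2-)
proof (induction arbitrary: f n)
  case (elementary k s)
  let ?s = "SMap ((subdiv ^^ Suc k) A) s ((subdiv ^^ k) A)"
  have "(smap_subdiv ^^ n) ?s \<in> selection_steps A"
    using selection_steps.elementary[OF elementary.hyps]
    by (induction n) (auto simp del: funpow.simps(1) intro: selection_steps.subdivision)
  then show ?case
    using selection_amalgam_step[OF A elementary.prems(1)] elementary.prems(2)
      selection_steps_selections by metis
next
  case identity
  have id: "(smap_subdiv ^^ n) (smap_id A) = smap_id ((subdiv ^^ n) A)"
    by (induction n) (simp_all add: smap_subdiv_id)
  have "amalgam_square (smap_id (target f)) f (smap_id (source f)) f"
    by (rule amalgam_square_id[OF selections_simplicial[OF A identity.prems(1)]])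
  then have "amalgam_square f ((smap_subdiv ^^ n) (smap_id A)) f (smap_id (source f))"
    using identity.prems(2) unfolding id by (auto intro: amalgam_square_sym)
  moreover have "smap_id (source f) \<in> selections A"
    using selections_source_target(1)[OF identity.prems(1)] smap_id_in_selections by auto
  ultimately show ?case using identity.prems(1) by blast
next
  case (composition h g)
  let ?h = "(smap_subdiv ^^ n) h" and ?g = "(smap_subdiv ^^ n) g"
  have sel: "(smap_subdiv ^^ m) e \<in> selections A" if "e \<in> selections A" for e m
    using that by (induction m) (auto intro: selections.subdivision)
  have src: "source ((smap_subdiv ^^ m) g) = target ((smap_subdiv ^^ m) h)" for m
    using composition.hyps by (induction m) auto
  have comp: "(smap_subdiv ^^ m) (smap_comp g h) =
      smap_comp ((smap_subdiv ^^ m) g) ((smap_subdiv ^^ m) h)" for m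
    using src composition.hyps
    by (induction m) (simp_all add: smap_subdiv_comp selections_simplicial[OF A sel])
  \<comment> \<open>By functoriality the subdivided composite splits into \<open>?h\<close> followed
    by \<open>?g\<close>; \<open>f\<close> is amalgamated with \<open>?g\<close>, then the new side
    \<open>f1\<close> with \<open>?h\<close>.\<close>
  obtain f1 g1 where 1: "f1 \<in> selections A" "g1 \<in> selections A" "amalgam_square f ?g f1 g1"
    using composition.IH(2)[OF composition.prems(1), of n] composition.prems(2) comp by auto
  then have "target f1 = target ?h" using src by (simp add: amalgam_square_def)
  then obtain f2 h1 where 2: "f2 \<in> selections A" "h1 \<in> selections A"
    "amalgam_square f1 ?h f2 h1"
    using composition.IH(1)[OF 1(1)] by blast
  have "amalgam_square f (smap_comp ?g ?h) f2 (smap_comp g1 h1)"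
    using 1 2 composition.hyps composition.prems(1)
    by (intro amalgam_square_paste[OF A, where f' = f1]) (auto simp: src sel)
  moreover have "smap_comp g1 h1 \<in> selections A"
    using 1 2 by (intro selections.composition) (auto simp: amalgam_square_def)
  ultimately show ?case using 2(1) comp by metis
next
  case (subdivision g)
  then show ?case
    using subdivision.IH[of f "Suc n"] by (simp add: funpow_swap1)
qed

section \<open>Verification of the axioms\<close>

theorem theorem3p2:
  fixes A :: "'a vert fset set"
  assumes "simplicial_complex A" and "finite A"
  shows "projective_fraisse_category (selection_category A)"
proof -
  let ?S = "selection_category A"
  note simp' = selections_simplicial[OF assms(1)]
  have ob: "Ob ?S = range (\<lambda>k. (subdiv ^^ k) A)"
    and [simp]: "Mor ?S = selections A" "Dom ?S = source" "Cod ?S = target" "Id ?S = smap_id"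
      "Comp ?S = smap_comp"
    by (simp_all add: selection_category_def)
  show ?thesis
  proof unfold_locales
    show "\<exists>R \<subseteq> Ob ?S. countable R \<and> (\<forall>x \<in> Ob ?S. \<exists>r \<in> R. isomorphic ?S x r)"
    \<comment> \<open>All objects together serve as \<open>R\<close>: they are indexed by the
      naturals, and each is isomorphic to itself by its identity.\<close>
    proof (intro exI conjI ballI)
      show "Ob ?S \<subseteq> Ob ?S" "countable (Ob ?S)" by (simp_all add: ob)
      fix x assume x: "x \<in> Ob ?S"
      then have id: "smap_id x \<in> selections A" using smap_id_in_selections by (auto simp: ob)
      then have "smap_comp (smap_id x) (smap_id x) = smap_id x"
        using smap_comp_id[OF simp'] by fastforce
      with id have "isomorphic ?S x x"
        unfolding isomorphic_def Hom_def by (intro bexI[of _ "smap_id x"]) auto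
      with x show "\<exists>r \<in> Ob ?S. isomorphic ?S x r" by blast
    qed
  next
    fix x y assume "x \<in> Ob ?S" "y \<in> Ob ?S"
    then show "countable (Hom ?S x y)"
      using assms finite_subdiv_iterate[OF assms(2)]
      by (auto simp: ob Hom_def intro!: countable_finite finite_selections_between)
  next
    fix o1 o2 assume "o1 \<in> Ob ?S" "o2 \<in> Ob ?S"
    \<comment> \<open>The common source is the (m+n)-th subdivision of \<open>A\<close>.\<close>
    then obtain m n where "o1 = (subdiv ^^ m) A" "o2 = (subdiv ^^ n) A" by (auto simp: ob)
    then show "\<exists>e1 \<in> Mor ?S. \<exists>e2 \<in> Mor ?S. Cod ?S e1 = o1 \<and> Cod ?S e2 = o2 \<and> Dom ?S e1 = Dom ?S e2"
      using selection_down[OF assms(1), of n m] selection_down[OF assms(1), of m n]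
      by (auto simp: add.commute) metis
  next
    fix e1 e2 assume "e1 \<in> Mor ?S" "e2 \<in> Mor ?S" "Cod ?S e1 = Cod ?S e2"
    then show "\<exists>e1' \<in> Mor ?S. \<exists>e2' \<in> Mor ?S. Cod ?S e1' = Dom ?S e1 \<and> Cod ?S e2' = Dom ?S e2 \<and>
        Dom ?S e1' = Dom ?S e2' \<and> Comp ?S e1 e1' = Comp ?S e2 e2'"
      \<comment> \<open>With exponent 0, \<open>e2\<close> itself is the map inducted on;
        \<open>e1'\<close> is the side opposite \<open>e2\<close>, and \<open>e2'\<close> the side
        opposite \<open>e1\<close>.\<close>
      using selection_amalgam[OF assms(1), of e2 e1 0] by (auto simp: amalgam_square_def) metis
  qed (auto simp: ob smap_comp_assoc smap_comp_id smap_id_comp simp' smap_id_in_selections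
      intro: selections.composition dest: selections_source_target)
qed

end
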